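(* Let $R$ be a ring, let $\lambda \geq \operatorname{card}(R)+\aleph_0$ be a cardinal and let $\delta<\lambda^+$ be a limit ordinal. If $M$ is a $(\lambda,\delta)$-limit model, then $M$ is $\operatorname{cf}(\delta)$-injective. In particular, if $\operatorname{cf}(\delta) \geq \gamma(R)$, then $M$ is injective.
   Context: Rings are associative with unity, modules are left $R$-modules, ideals are left ideals; $\operatorname{card}(R)$ is the cardinality of $R$, $\|M\|$ the cardinality of a module $M$, and $N \subseteq_R M$ means $N$ is a submodule of $M$. $\operatorname{cf}(\delta)$ is the cofinality of $\delta$. For an infinite cardinal $\mu$: an ideal is $(<\mu)$-generated if it is generated by a set of fewer than $\mu$ elements. A module $M$ is $\mu$-injective if for every $(<\mu)$-generated left ideal $I$ of $R$, every homomorphism $I \to M$ extends to a homomorphism $R \to M$. $\gamma(R)$ is the minimum infinite cardinal such that every left ideal of $R$ is $(<\gamma(R))$-generated. Limit models (in the class of all left $R$-modules with embeddings): $M$ is universal over $N$ if $\|M\|=\|N\|$, $N \subseteq_R M$, and for every module $N^*$ with $\|N^*\|=\|M\|$ and $N\subseteq_R N^*$ there is an embedding $f: N^* \to M$ with $f\restriction N=\mathrm{id}_N$. For an infinite cardinal $\lambda$ and a limit ordinal $\alpha<\lambda^+$, $M$ is a $(\lambda,\alpha)$-limit model if there is an increasing continuous chain $\{M_i : i<\alpha\}$ of modules of cardinality $\lambda$ (continuous: $M_i=\bigcup_{j<i}M_j$ for limit $i<\alpha$) such that $M_{i+1}$ is universal over $M_i$ for each $i<\alpha$ and $M=\bigcup_{i<\alpha}M_i$.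 *)

theory Defs
  imports "HOL-Algebra.Ideal" "HOL-Algebra.Module"
begin

unbundle cardinal_syntax

section \<open>Left modules over a not necessarily commutative ring\<close>

text \<open>The locale \<^locale>\<open>module\<close> of HOL-Algebra requires a commutative ring of scalars; the axioms
  below are the same ones over a \<^locale>\<open>ring\<close>. The record type of HOL-Algebra is reused, its fields
  \<^const>\<open>mult\<close> and \<^const>\<open>one\<close> carry no information.\<close>

locale left_module = R?: ring R + M?: abelian_group M
  for R :: "('a, 'r) ring_scheme" (structure) and M :: "('a, 'b) module" (structure) +
  assumes smult_closed:
      "\<lbrakk>a \<in> carrier R; x \<in> carrier M\<rbrakk> \<Longrightarrow> a \<odot>\<^bsub>M\<^esub> x \<in> carrier M"
    and smult_l_distr:
      "\<lbrakk>a \<in> carrier R; b \<in> carrier R; x \<in> carrier M\<rbrakk>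
        \<Longrightarrow> (a \<oplus>\<^bsub>R\<^esub> b) \<odot>\<^bsub>M\<^esub> x = a \<odot>\<^bsub>M\<^esub> x \<oplus>\<^bsub>M\<^esub> b \<odot>\<^bsub>M\<^esub> x"
    and smult_r_distr:
      "\<lbrakk>a \<in> carrier R; x \<in> carrier M; y \<in> carrier M\<rbrakk>
        \<Longrightarrow> a \<odot>\<^bsub>M\<^esub> (x \<oplus>\<^bsub>M\<^esub> y) = a \<odot>\<^bsub>M\<^esub> x \<oplus>\<^bsub>M\<^esub> a \<odot>\<^bsub>M\<^esub> y"
    and smult_assoc1:
      "\<lbrakk>a \<in> carrier R; b \<in> carrier R; x \<in> carrier M\<rbrakk>
        \<Longrightarrow> (a \<otimes>\<^bsub>R\<^esub> b) \<odot>\<^bsub>M\<^esub> x = a \<odot>\<^bsub>M\<^esub> (b \<odot>\<^bsub>M\<^esub> x)"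
    and smult_one: "x \<in> carrier M \<Longrightarrow> \<one>\<^bsub>R\<^esub> \<odot>\<^bsub>M\<^esub> x = x"

definition left_submodule ::
    "('a, 'r) ring_scheme \<Rightarrow> ('a, 'b) module \<Rightarrow> ('a, 'b) module \<Rightarrow> bool" where
  "left_submodule R N M \<longleftrightarrow>
     left_module R N \<and> left_module R M \<and> carrier N \<subseteq> carrier M \<and>
     (\<forall>x\<in>carrier N. \<forall>y\<in>carrier N. x \<oplus>\<^bsub>N\<^esub> y = x \<oplus>\<^bsub>M\<^esub> y) \<and>
     (\<forall>a\<in>carrier R. \<forall>x\<in>carrier N. a \<odot>\<^bsub>N\<^esub> x = a \<odot>\<^bsub>M\<^esub> x)"

definition left_hom ::
    "('a, 'r) ring_scheme \<Rightarrow> ('a, 'b) module \<Rightarrow> ('a, 'c) module \<Rightarrow> ('b \<Rightarrow> 'c) set" where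
  "left_hom R M N =
     {f \<in> carrier M \<rightarrow> carrier N.
        (\<forall>x\<in>carrier M. \<forall>y\<in>carrier M. f (x \<oplus>\<^bsub>M\<^esub> y) = f x \<oplus>\<^bsub>N\<^esub> f y) \<and>
        (\<forall>a\<in>carrier R. \<forall>x\<in>carrier M. f (a \<odot>\<^bsub>M\<^esub> x) = a \<odot>\<^bsub>N\<^esub> f x)}"

definition left_embedding ::
    "('a, 'r) ring_scheme \<Rightarrow> ('a, 'b) module \<Rightarrow> ('a, 'c) module \<Rightarrow> ('b \<Rightarrow> 'c) set" where
  "left_embedding R M N = {f \<in> left_hom R M N. inj_on f (carrier M)}"

text \<open>A module is injective if homomorphisms into it extend from submodules. HOL cannot quantify over
  types inside a formula, so the type of the test modules is a parameter; injectivity is the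
  statement for a type variable \<open>'c\<close> not occurring elsewhere, i.e. for every type.\<close>

definition left_injective ::
    "'c itself \<Rightarrow> ('a, 'r) ring_scheme \<Rightarrow> ('a, 'b) module \<Rightarrow> bool" where
  "left_injective _ R M \<longleftrightarrow>
     left_module R M \<and>
     (\<forall>(A :: ('a, 'c) module) (B :: ('a, 'c) module). left_submodule R A B \<longrightarrow>
        (\<forall>f \<in> left_hom R A M. \<exists>g \<in> left_hom R B M. \<forall>x\<in>carrier A. g x = f x))"


section \<open>Left ideals\<close>

definition left_ideal :: "('a, 'r) ring_scheme \<Rightarrow> 'a set \<Rightarrow> bool" where
  "left_ideal R I \<longleftrightarrow>
     additive_subgroup I R \<and> (\<forall>a\<in>carrier R. \<forall>x\<in>I. a \<otimes>\<^bsub>R\<^esub> x \<in> I)"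

definition left_ideal_gen :: "('a, 'r) ring_scheme \<Rightarrow> 'a set \<Rightarrow> 'a set" where
  "left_ideal_gen R A = \<Inter> {I. left_ideal R I \<and> A \<subseteq> I}"

definition lt_generated :: "('a, 'r) ring_scheme \<Rightarrow> 'm rel \<Rightarrow> 'a set \<Rightarrow> bool" where
  "lt_generated R \<mu> I \<longleftrightarrow> (\<exists>A \<subseteq> carrier R. |A| <o \<mu> \<and> I = left_ideal_gen R A)"

text \<open>A left ideal \<open>I\<close> as a left module; \<open>I = carrier R\<close> gives the ring as a module over itself.\<close>

definition ideal_module :: "('a, 'r) ring_scheme \<Rightarrow> 'a set \<Rightarrow> ('a, 'a) module" where
  "ideal_module R I =
     \<lparr>carrier = I, monoid.mult = mult R, one = one R, zero = zero R, add = add R, smult = mult R\<rparr>"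

definition mu_injective ::
    "('a, 'r) ring_scheme \<Rightarrow> 'm rel \<Rightarrow> ('a, 'b) module \<Rightarrow> bool" where
  "mu_injective R \<mu> M \<longleftrightarrow>
     left_module R M \<and>
     (\<forall>I. left_ideal R I \<and> lt_generated R \<mu> I \<longrightarrow>
        (\<forall>f \<in> left_hom R (ideal_module R I) M.
           \<exists>g \<in> left_hom R (ideal_module R (carrier R)) M. \<forall>x\<in>I. g x = f x))"

definition gamma_bound :: "('a, 'r) ring_scheme \<Rightarrow> 'm rel \<Rightarrow> bool" where
  "gamma_bound R \<kappa> \<longleftrightarrow> Cinfinite \<kappa> \<and> (\<forall>I. left_ideal R I \<longrightarrow> lt_generated R \<kappa> I)"

text \<open>The least such cardinal. The type chosen to represent it is large enough, and minimality holds
  against cardinals on every type: see \<open>gamma_bound_gamma\<close> and \<open>gamma_least\<close>.\<close>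

definition gamma :: "('a, 'r) ring_scheme \<Rightarrow> ('a + nat) set rel" where
  "gamma R = (SOME \<kappa>. gamma_bound R \<kappa> \<and>
     (\<forall>\<kappa>' :: ('a + nat) set rel. gamma_bound R \<kappa>' \<longrightarrow> \<kappa> \<le>o \<kappa>'))"


section \<open>Limit ordinals and cofinality\<close>

text \<open>Ordinals are well-orders, compared by \<open><o\<close>; the ordinals below \<open>\<delta>\<close> are the elements of
  \<open>Field \<delta>\<close>, where \<open>i\<close> stands for the order type of its set \<open>underS \<delta> i\<close> of predecessors.
  Zero is not a limit ordinal.\<close>

definition limit_ordinal :: "'i rel \<Rightarrow> bool" where
  "limit_ordinal \<delta> \<longleftrightarrow>
     Well_order \<delta> \<and> Field \<delta> \<noteq> {} \<and> (\<forall>i\<in>Field \<delta>. \<exists>j\<in>Field \<delta>. i \<noteq> j \<and> (i, j) \<in> \<delta>)"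


definition cofinality :: "'i rel \<Rightarrow> 'i rel" where
  "cofinality \<delta> = |SOME A. A \<subseteq> Field \<delta> \<and> cofinal A \<delta> \<and>
     (\<forall>B. B \<subseteq> Field \<delta> \<and> cofinal B \<delta> \<longrightarrow> |A| \<le>o |B| )|"


section \<open>Limit models\<close>

text \<open>\<open>M\<close> is universal over \<open>N\<close>. An extension \<open>N \<subseteq> N\<^sup>*\<close> is given up to isomorphism over \<open>N\<close>, as an
  embedding \<open>g\<close> of \<open>N\<close> into \<open>N\<^sup>*\<close>. Demanding a literal inclusion in the type \<open>'b\<close> would lose
  extensions for which \<open>'b\<close> has no room outside \<open>N\<close>, whereas with embeddings the type \<open>'b\<close> is no
  restriction: see \<open>universal_over_all_types\<close>.\<close>

definition universal_over ::
    "('a, 'r) ring_scheme \<Rightarrow> ('a, 'b) module \<Rightarrow> ('a, 'b) module \<Rightarrow> bool" where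
  "universal_over R M N \<longleftrightarrow>
     |carrier M| =o |carrier N| \<and> left_submodule R N M \<and>
     (\<forall>(N' :: ('a, 'b) module) g.
        left_module R N' \<and> |carrier N'| =o |carrier M| \<and> g \<in> left_embedding R N N' \<longrightarrow>
        (\<exists>f \<in> left_embedding R N' M. \<forall>x\<in>carrier N. f (g x) = x))"

text \<open>Here \<open>wo_rel.suc \<delta> {i}\<close> is the ordinal \<open>i + 1\<close>.\<close>

definition limit_model ::
    "('a, 'r) ring_scheme \<Rightarrow> 'l rel \<Rightarrow> 'i rel \<Rightarrow> ('a, 'b) module \<Rightarrow> bool" where
  "limit_model R lam \<delta> M \<longleftrightarrow>
     (\<exists>C :: 'i \<Rightarrow> ('a, 'b) module.
        (\<forall>i\<in>Field \<delta>. left_module R (C i) \<and> |carrier (C i)| =o lam) \<and>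
        (\<forall>i j. (i, j) \<in> \<delta> \<longrightarrow> left_submodule R (C i) (C j)) \<and>
        (\<forall>i\<in>Field \<delta>. limit_ordinal (Restr \<delta> (underS \<delta> i)) \<longrightarrow>
           carrier (C i) = (\<Union>j\<in>underS \<delta> i. carrier (C j))) \<and>
        (\<forall>i\<in>Field \<delta>. universal_over R (C (wo_rel.suc \<delta> {i})) (C i)) \<and>
        (\<forall>i\<in>Field \<delta>. left_submodule R (C i) M) \<and>
        carrier M = (\<Union>i\<in>Field \<delta>. carrier (C i)))"


section \<open>Independence of the representing types\<close>

lemma left_ideal_gen_self: "left_ideal R I \<Longrightarrow> left_ideal_gen R I = I"
  by (auto simp: left_ideal_gen_def)

lemma gamma_exists:
  "\<exists>\<kappa> :: ('a + nat) set rel. gamma_bound (R :: ('a, 'r) ring_scheme) \<kappa> \<and>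
     (\<forall>\<kappa>' :: ('a + nat) set rel. gamma_bound R \<kappa>' \<longrightarrow> \<kappa> \<le>o \<kappa>')"
proof -
  let ?k = "cardSuc |UNIV :: ('a + nat) set|"
  have inf: "Cinfinite |UNIV :: ('a + nat) set|"
    using card_of_Card_order by (auto simp: cinfinite_def Field_card_of finite_Plus_UNIV_iff)
  have "lt_generated R ?k I" if I: "left_ideal R I" for I
  proof -
    have "|I| \<le>o |UNIV :: ('a + nat) set|"
      using card_of_ordLeqI[of Inl I "UNIV :: ('a + nat) set"] by (simp add: inj_on_def)
    then have "|I| <o ?k"
      using cardSuc_greater[of "|UNIV :: ('a + nat) set|"] ordLeq_ordLess_trans
        card_of_Card_order by blast
    moreover have "I \<subseteq> carrier R"
      using I by (auto simp: left_ideal_def dest: additive_subgroup.a_subset)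
    ultimately show ?thesis
      using left_ideal_gen_self[OF I] unfolding lt_generated_def by auto
  qed
  then have "gamma_bound R ?k"
    using Cinfinite_cardSuc[OF inf] by (simp add: gamma_bound_def)
  then have "{\<kappa> :: ('a + nat) set rel. gamma_bound R \<kappa>} \<noteq> {}" by blast
  moreover have "\<forall>r \<in> {\<kappa> :: ('a + nat) set rel. gamma_bound R \<kappa>}. Well_order r"
    by (auto simp: gamma_bound_def card_order_on_def)
  ultimately show ?thesis
    using exists_minim_Well_order[of "{\<kappa> :: ('a + nat) set rel. gamma_bound R \<kappa>}"] by simp
qed

lemma gamma_bound_gamma: "gamma_bound R (gamma R)"
  unfolding gamma_def by (rule someI2_ex[OF gamma_exists]) simp

lemma gamma_least:
  assumes "gamma_bound R (\<kappa> :: 'k rel)"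
  shows "gamma R \<le>o \<kappa>"
proof (rule ccontr)
  assume n: "\<not> gamma R \<le>o \<kappa>"
  have co: "Card_order \<kappa>" "Card_order (gamma R)"
    using assms gamma_bound_gamma[of R] by (auto simp: gamma_bound_def)
  have "\<kappa> \<le>o gamma R"
    using n co by (meson Card_order_wo_rel wo_rel.WELL ordLeq_total)
  then have "|Field \<kappa>| \<le>o |Field (gamma R)|"
    by (rule card_of_mono2)
  then obtain h where h: "inj_on h (Field \<kappa>)" "h ` Field \<kappa> \<subseteq> Field (gamma R)"
    using card_of_ordLeq[of "Field \<kappa>" "Field (gamma R)"] by blast
  let ?A = "h ` Field \<kappa>"
  have "|Field \<kappa>| =o |?A|"
    using card_of_ordIsoI[OF inj_on_imp_bij_betw[OF h(1)]] .
  then have iso: "\<kappa> =o |?A|"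
    by (rule ordIso_transitive[OF ordIso_symmetric[OF card_of_Field_ordIso[OF co(1)]]])
  have "gamma_bound R ( |?A| )"
    unfolding gamma_bound_def
  proof (intro conjI allI impI)
    show "cinfinite |?A|"
      using assms h(1) by (auto simp: gamma_bound_def cinfinite_def Field_card_of finite_image_iff)
    show "Card_order |?A|" by (rule card_of_Card_order)
    fix I assume "left_ideal R I"
    then have "lt_generated R \<kappa> I" using assms by (auto simp: gamma_bound_def)
    then obtain B where "B \<subseteq> carrier R" "|B| <o \<kappa>" "I = left_ideal_gen R B"
      by (auto simp: lt_generated_def)
    then show "lt_generated R ( |?A| ) I"
      unfolding lt_generated_def using ordLess_ordIso_trans[OF _ iso] by auto
  qed
  moreover have "\<forall>\<kappa>' :: ('a + nat) set rel. gamma_bound R \<kappa>' \<longrightarrow> gamma R \<le>o \<kappa>'"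
    for R :: "('a, 'r) ring_scheme"
    unfolding gamma_def by (rule someI2_ex[OF gamma_exists]) simp
  ultimately have "gamma R \<le>o |?A|" by blast
  then have "gamma R \<le>o \<kappa>"
    by (rule ordLeq_ordIso_trans[OF _ ordIso_symmetric[OF iso]])
  with n show False ..
qed

lemma cofinality_least:
  assumes "limit_ordinal \<delta>"
  shows "\<exists>A \<subseteq> Field \<delta>. cofinal A \<delta> \<and> cofinality \<delta> = |A|"
    and "\<lbrakk>B \<subseteq> Field \<delta>; cofinal B \<delta>\<rbrakk> \<Longrightarrow> cofinality \<delta> \<le>o |B|"
proof -
  let ?S = "card_of ` {A. A \<subseteq> Field \<delta> \<and> cofinal A \<delta>}"
  have "Field \<delta> \<in> {A. A \<subseteq> Field \<delta> \<and> cofinal A \<delta>}"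
    using assms by (auto simp: limit_ordinal_def cofinal_def)
  then have "\<exists>r\<in>?S. \<forall>r'\<in>?S. r \<le>o r'"
    by (intro exists_minim_Well_order) (auto simp: card_of_Well_order)
  then have ex: "\<exists>A. A \<subseteq> Field \<delta> \<and> cofinal A \<delta> \<and>
      (\<forall>B. B \<subseteq> Field \<delta> \<and> cofinal B \<delta> \<longrightarrow> |A| \<le>o |B| )" by blast
  from someI_ex[OF ex] show "\<exists>A \<subseteq> Field \<delta>. cofinal A \<delta> \<and> cofinality \<delta> = |A|"
    unfolding cofinality_def by (intro exI conjI) auto
  from someI_ex[OF ex] show "\<lbrakk>B \<subseteq> Field \<delta>; cofinal B \<delta>\<rbrakk> \<Longrightarrow> cofinality \<delta> \<le>o |B|"
    unfolding cofinality_def by simp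
qed

lemma universal_over_all_types:
  fixes N' :: "('a, 'c) module" and M :: "('a, 'b) module"
  assumes univ: "universal_over R M N"
    and N': "left_module R N'" "|carrier N'| =o |carrier M|" and g: "g \<in> left_embedding R N N'"
  shows "\<exists>f \<in> left_embedding R N' M. \<forall>x\<in>carrier N. f (g x) = x"
proof -
  interpret N': left_module R N' by (rule N')
  obtain h where h: "bij_betw h (carrier N') (carrier M)"
    using N'(2) card_of_ordIso by blast
  define k where "k = inv_into (carrier N') h"
  have hc: "\<And>x. x \<in> carrier N' \<Longrightarrow> h x \<in> carrier M"
    and kc: "\<And>y. y \<in> carrier M \<Longrightarrow> k y \<in> carrier N'"
    and kh: "\<And>x. x \<in> carrier N' \<Longrightarrow> k (h x) = x"
    and hk: "\<And>y. y \<in> carrier M \<Longrightarrow> h (k y) = y"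
    using h unfolding k_def
    by (auto simp: bij_betw_def inv_into_into f_inv_into_f)
  define P :: "('a, 'b) module" where
    "P = \<lparr>carrier = carrier M, monoid.mult = undefined, one = undefined, zero = h \<zero>\<^bsub>N'\<^esub>,
          add = (\<lambda>x y. h (k x \<oplus>\<^bsub>N'\<^esub> k y)), smult = (\<lambda>a x. h (a \<odot>\<^bsub>N'\<^esub> k x))\<rparr>"
  have P: "carrier P = carrier M" "zero P = h \<zero>\<^bsub>N'\<^esub>"
      "\<And>x y. x \<oplus>\<^bsub>P\<^esub> y = h (k x \<oplus>\<^bsub>N'\<^esub> k y)" "\<And>a x. a \<odot>\<^bsub>P\<^esub> x = h (a \<odot>\<^bsub>N'\<^esub> k x)"
    by (simp_all add: P_def)
  have "abelian_group P"
  proof (rule abelian_groupI)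
    fix x assume "x \<in> carrier P"
    then have x: "k x \<in> carrier N'" by (simp add: P kc)
    show "\<exists>y\<in>carrier P. y \<oplus>\<^bsub>P\<^esub> x = \<zero>\<^bsub>P\<^esub>"
      using x by (intro bexI[of _ "h (\<ominus>\<^bsub>N'\<^esub> k x)"]) (simp_all add: P hc kh N'.M.l_neg)
  qed (simp_all add: P hc kc kh hk N'.M.a_ac)
  then have P_module: "left_module R P"
    by (intro left_module.intro left_module_axioms.intro N'.R.ring_axioms)
      (simp_all add: P hc kc kh hk N'.smult_closed N'.smult_l_distr N'.smult_r_distr
        N'.smult_assoc1 N'.smult_one)
  have P_card: "|carrier P| =o |carrier M|"
    by (simp add: P card_of_refl)
  have gh: "g \<in> carrier N \<rightarrow> carrier N'" "inj_on g (carrier N)"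
    using g by (auto simp: left_embedding_def left_hom_def)
  have hinj: "inj_on h (carrier N')" using h by (rule bij_betw_imp_inj_on)
  have "inj_on (h \<circ> g) (carrier N)"
    using gh hinj by (intro comp_inj_on inj_on_subset[OF hinj]) auto
  moreover have "h \<circ> g \<in> left_hom R N P"
    using g gh by (auto simp: left_embedding_def left_hom_def P hc kh Pi_iff)
  ultimately have "h \<circ> g \<in> left_embedding R N P"
    by (simp add: left_embedding_def)
  then obtain f where f: "f \<in> left_embedding R P M" "\<forall>x\<in>carrier N. f ((h \<circ> g) x) = x"
    using univ P_module P_card unfolding universal_over_def by blast
  have add: "f (h x \<oplus>\<^bsub>P\<^esub> h y) = f (h x) \<oplus>\<^bsub>M\<^esub> f (h y)"
    if "x \<in> carrier N'" "y \<in> carrier N'" for x y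
    using f(1) that by (simp add: left_embedding_def left_hom_def P(1) hc)
  have smult: "f (a \<odot>\<^bsub>P\<^esub> h x) = a \<odot>\<^bsub>M\<^esub> f (h x)"
    if "a \<in> carrier R" "x \<in> carrier N'" for a x
    using f(1) that by (simp add: left_embedding_def left_hom_def P(1) hc)
  have "inj_on f (h ` carrier N')"
    using f(1) h by (simp add: left_embedding_def P(1) bij_betw_def)
  then have "inj_on (f \<circ> h) (carrier N')"
    using hinj by (rule comp_inj_on[rotated])
  moreover have "f \<circ> h \<in> left_hom R N' M"
    using f(1) add smult by (auto simp: left_embedding_def left_hom_def P hc kh Pi_iff)
  ultimately have "f \<circ> h \<in> left_embedding R N' M"
    by (simp add: left_embedding_def)
  then show ?thesis using f(2) by (intro bexI[of _ "f \<circ> h"]) auto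
qed

end

theory Submission
  imports Defs
begin

text \<open>A homomorphism \<open>f\<close> from a left ideal \<open>I\<close> with fewer than \<open>cf(\<delta>)\<close> generators into the union \<open>M\<close> of
  the chain sends all generators, hence \<open>I\<close>, into one member \<open>C j\<close>. The pushout of \<open>f\<close> along
  \<open>I \<subseteq> R\<close> extends \<open>C j\<close> and still has cardinality \<open>\<lambda>\<close>, so by universality it embeds into \<open>C (j + 1)\<close>
  over \<open>C j\<close>; composing with \<open>R \<rightarrow> pushout\<close> extends \<open>f\<close>. If \<open>cf(\<delta>) \<ge> \<gamma>(R)\<close> this applies to all
  left ideals, and Baer's criterion gives injectivity.\<close>

section \<open>Quotients and pushouts of left modules\<close>

lemma (in abelian_group) neg_zero: "\<ominus> \<zero> = \<zero>"
  by (rule minus_equality) simp_all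

lemma (in abelian_group) diff_eq_zeroD:
  assumes "x \<ominus> y = \<zero>" "x \<in> carrier G" "y \<in> carrier G"
  shows "x = y"
  using minus_equality[of x "\<ominus> y"] assms by (simp add: minus_eq)

context left_module
begin

lemma smult_l_null:
  assumes "x \<in> carrier M"
  shows "\<zero>\<^bsub>R\<^esub> \<odot>\<^bsub>M\<^esub> x = \<zero>\<^bsub>M\<^esub>"
proof -
  have c: "\<zero>\<^bsub>R\<^esub> \<odot>\<^bsub>M\<^esub> x \<in> carrier M" using assms by (simp add: smult_closed)
  have "\<zero>\<^bsub>R\<^esub> \<odot>\<^bsub>M\<^esub> x \<oplus>\<^bsub>M\<^esub> \<zero>\<^bsub>R\<^esub> \<odot>\<^bsub>M\<^esub> x = \<zero>\<^bsub>R\<^esub> \<odot>\<^bsub>M\<^esub> x"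
    using smult_l_distr[of "\<zero>\<^bsub>R\<^esub>" "\<zero>\<^bsub>R\<^esub>" x] assms by simp
  then show ?thesis using c by (simp add: M.add.l_cancel_one)
qed

lemma smult_r_null:
  assumes "a \<in> carrier R"
  shows "a \<odot>\<^bsub>M\<^esub> \<zero>\<^bsub>M\<^esub> = \<zero>\<^bsub>M\<^esub>"
proof -
  have c: "a \<odot>\<^bsub>M\<^esub> \<zero>\<^bsub>M\<^esub> \<in> carrier M" using assms by (simp add: smult_closed)
  have "a \<odot>\<^bsub>M\<^esub> \<zero>\<^bsub>M\<^esub> \<oplus>\<^bsub>M\<^esub> a \<odot>\<^bsub>M\<^esub> \<zero>\<^bsub>M\<^esub> = a \<odot>\<^bsub>M\<^esub> \<zero>\<^bsub>M\<^esub>"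
    using smult_r_distr[of a "\<zero>\<^bsub>M\<^esub>" "\<zero>\<^bsub>M\<^esub>"] assms by simp
  then show ?thesis using c by (simp add: M.add.l_cancel_one)
qed

lemma smult_l_minus:
  assumes "a \<in> carrier R" "x \<in> carrier M"
  shows "(\<ominus>\<^bsub>R\<^esub> a) \<odot>\<^bsub>M\<^esub> x = \<ominus>\<^bsub>M\<^esub> (a \<odot>\<^bsub>M\<^esub> x)"
proof -
  have "(\<ominus>\<^bsub>R\<^esub> a) \<odot>\<^bsub>M\<^esub> x \<oplus>\<^bsub>M\<^esub> a \<odot>\<^bsub>M\<^esub> x = \<zero>\<^bsub>M\<^esub>"
    using smult_l_distr[of "\<ominus>\<^bsub>R\<^esub> a" a x] assms by (simp add: R.l_neg smult_l_null)
  then show ?thesis using assms M.minus_equality by (simp add: smult_closed)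
qed

lemma smult_r_minus:
  assumes "a \<in> carrier R" "x \<in> carrier M"
  shows "a \<odot>\<^bsub>M\<^esub> (\<ominus>\<^bsub>M\<^esub> x) = \<ominus>\<^bsub>M\<^esub> (a \<odot>\<^bsub>M\<^esub> x)"
proof -
  have "a \<odot>\<^bsub>M\<^esub> (\<ominus>\<^bsub>M\<^esub> x) \<oplus>\<^bsub>M\<^esub> a \<odot>\<^bsub>M\<^esub> x = \<zero>\<^bsub>M\<^esub>"
    using smult_r_distr[of a "\<ominus>\<^bsub>M\<^esub> x" x] assms by (simp add: M.l_neg smult_r_null)
  then show ?thesis using assms M.minus_equality by (simp add: smult_closed)
qed

text \<open>With this, a set closed under scalars is closed under negation, so submodules and graphs
  need no separate clause for inverses.\<close>

lemma minus_smult_one: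
  "x \<in> carrier M \<Longrightarrow> (\<ominus>\<^bsub>R\<^esub> \<one>\<^bsub>R\<^esub>) \<odot>\<^bsub>M\<^esub> x = \<ominus>\<^bsub>M\<^esub> x"
  by (simp add: smult_l_minus smult_one)

text \<open>The quotient of \<open>M\<close> by the submodule \<open>K\<close>, carried by a set of
  representatives instead of cosets, so that it stays in the type \<open>'b\<close>. Later arguments
  see only a surjective homomorphism \<open>q\<close> that identifies exactly the elements congruent
  modulo \<open>K\<close>.\<close>

lemma quotient_exists:
  assumes K: "K \<subseteq> carrier M" "\<zero>\<^bsub>M\<^esub> \<in> K"
    and K_add: "\<And>x y. \<lbrakk>x \<in> K; y \<in> K\<rbrakk> \<Longrightarrow> x \<oplus>\<^bsub>M\<^esub> y \<in> K"
    and K_smult: "\<And>a x. \<lbrakk>a \<in> carrier R; x \<in> K\<rbrakk> \<Longrightarrow> a \<odot>\<^bsub>M\<^esub> x \<in> K"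
  shows "\<exists>(Q :: ('a, 'b) module) q. left_module R Q \<and> q \<in> left_hom R M Q \<and>
    q ` carrier M = carrier Q \<and>
    (\<forall>x\<in>carrier M. \<forall>y\<in>carrier M. q x = q y \<longleftrightarrow> x \<ominus>\<^bsub>M\<^esub> y \<in> K)"
proof -
  have K_neg: "\<ominus>\<^bsub>M\<^esub> x \<in> K" if "x \<in> K" for x
    using K_smult[of "\<ominus>\<^bsub>R\<^esub> \<one>\<^bsub>R\<^esub>" x] that K by (auto simp: minus_smult_one)
  define E where "E x y \<longleftrightarrow> x \<ominus>\<^bsub>M\<^esub> y \<in> K" for x y
  have E_refl: "E x x" if "x \<in> carrier M" for x
    using that K by (simp add: E_def M.minus_eq M.r_neg)
  have E_sym: "E y x" if "E x y" "x \<in> carrier M" "y \<in> carrier M" for x y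
    using K_neg[of "x \<ominus>\<^bsub>M\<^esub> y"] that
    by (simp add: E_def M.minus_eq M.minus_add M.a_comm)
  have diff_add: "(x \<oplus>\<^bsub>M\<^esub> z) \<ominus>\<^bsub>M\<^esub> (y \<oplus>\<^bsub>M\<^esub> w) = (x \<ominus>\<^bsub>M\<^esub> y) \<oplus>\<^bsub>M\<^esub> (z \<ominus>\<^bsub>M\<^esub> w)"
    if "x \<in> carrier M" "y \<in> carrier M" "z \<in> carrier M" "w \<in> carrier M" for x y z w
    using that by (simp add: M.minus_eq M.minus_add M.a_ac)
  have E_add: "E (x \<oplus>\<^bsub>M\<^esub> z) (y \<oplus>\<^bsub>M\<^esub> w)"
    if "E x y" "E z w" "x \<in> carrier M" "y \<in> carrier M" "z \<in> carrier M" "w \<in> carrier M" for x y z w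
    using that K_add by (simp add: E_def diff_add)
  have E_trans: "E x z" if "E x y" "E y z" "x \<in> carrier M" "y \<in> carrier M" "z \<in> carrier M" for x y z
  proof -
    have "(x \<ominus>\<^bsub>M\<^esub> y) \<oplus>\<^bsub>M\<^esub> (y \<ominus>\<^bsub>M\<^esub> z) = x \<ominus>\<^bsub>M\<^esub> z"
      using that by (simp add: M.minus_eq M.a_assoc M.r_neg1)
    then show ?thesis using that K_add[of "x \<ominus>\<^bsub>M\<^esub> y" "y \<ominus>\<^bsub>M\<^esub> z"] by (simp add: E_def)
  qed
  have E_smult: "E (a \<odot>\<^bsub>M\<^esub> x) (a \<odot>\<^bsub>M\<^esub> y)"
    if "E x y" "a \<in> carrier R" "x \<in> carrier M" "y \<in> carrier M" for a x y
    using K_smult[of a "x \<ominus>\<^bsub>M\<^esub> y"] that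
    by (simp add: E_def M.minus_eq smult_r_distr smult_r_minus)
  \<comment> \<open>\<open>q\<close> sends an element to a chosen member of its class modulo
    \<open>K\<close>; reflexivity of \<open>E\<close> guarantees a candidate.\<close>
  define q where "q x = (SOME y. y \<in> carrier M \<and> E x y)" for x
  have q: "q x \<in> carrier M" "E x (q x)" if "x \<in> carrier M" for x
    using someI[of "\<lambda>y. y \<in> carrier M \<and> E x y" x] that E_refl unfolding q_def by blast+
  have q_eq: "q x = q y \<longleftrightarrow> E x y" if "x \<in> carrier M" "y \<in> carrier M" for x y
  proof
    assume "q x = q y"
    then show "E x y" using q[of x] q[of y] that E_trans E_sym by metis
  next
    assume "E x y"
    \<comment> \<open>Equivalent elements have the same candidates, and \<open>SOME\<close> depends
      on the predicate alone, so both receive the same representative.\<close>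
    then have "(\<lambda>z. z \<in> carrier M \<and> E x z) = (\<lambda>z. z \<in> carrier M \<and> E y z)"
      using that E_trans E_sym by blast
    then show "q x = q y" by (simp add: q_def)
  qed
  define Q :: "('a, 'b) module" where
    "Q = \<lparr>carrier = q ` carrier M, monoid.mult = undefined, one = undefined, zero = q \<zero>\<^bsub>M\<^esub>,
          add = (\<lambda>x y. q (x \<oplus>\<^bsub>M\<^esub> y)), smult = (\<lambda>a x. q (a \<odot>\<^bsub>M\<^esub> x))\<rparr>"
  have Q: "carrier Q = q ` carrier M" "zero Q = q \<zero>\<^bsub>M\<^esub>"
    by (simp_all add: Q_def)
  \<comment> \<open>The left side unfolds to the representative of the sum of \<open>q x\<close> and
    \<open>q y\<close>. These are congruent to \<open>x\<close> and \<open>y\<close>, and addition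
    respects congruence.\<close>
  have q_add: "q x \<oplus>\<^bsub>Q\<^esub> q y = q (x \<oplus>\<^bsub>M\<^esub> y)" if "x \<in> carrier M" "y \<in> carrier M" for x y
    using that q E_add E_sym by (simp add: Q_def q_eq)
  have q_smult: "a \<odot>\<^bsub>Q\<^esub> q x = q (a \<odot>\<^bsub>M\<^esub> x)" if "a \<in> carrier R" "x \<in> carrier M" for a x
    using that q E_smult E_sym by (simp add: Q_def q_eq smult_closed)
  have "abelian_group Q"
  proof (rule abelian_groupI)
    fix x assume "x \<in> carrier Q"
    then obtain z where "z \<in> carrier M" "x = q z" by (auto simp: Q)
    then show "\<exists>y\<in>carrier Q. y \<oplus>\<^bsub>Q\<^esub> x = \<zero>\<^bsub>Q\<^esub>"
      by (intro bexI[of _ "q (\<ominus>\<^bsub>M\<^esub> z)"]) (simp_all add: Q q_add M.l_neg)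
  qed (auto simp: Q q_add M.a_ac)
  then have "left_module R Q"
    by (intro left_module.intro left_module_axioms.intro R.ring_axioms)
      (auto simp: Q q_add q_smult smult_closed smult_l_distr smult_r_distr smult_assoc1 smult_one)
  moreover have "q \<in> left_hom R M Q"
    by (simp add: left_hom_def Q q_add q_smult)
  ultimately show ?thesis
    using q_eq unfolding E_def by (intro exI[of _ Q] exI[of _ q]) (simp add: Q)
qed

end

section \<open>Direct sums and pushouts\<close>

definition direct_sum :: "('a, 'b) module \<Rightarrow> ('a, 'c) module \<Rightarrow> ('a, 'b \<times> 'c) module" where
  "direct_sum M N =
     \<lparr>carrier = carrier M \<times> carrier N, monoid.mult = undefined, one = undefined,
      zero = (\<zero>\<^bsub>M\<^esub>, \<zero>\<^bsub>N\<^esub>), add = (\<lambda>x y. (fst x \<oplus>\<^bsub>M\<^esub> fst y, snd x \<oplus>\<^bsub>N\<^esub> snd y)),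
      smult = (\<lambda>a x. (a \<odot>\<^bsub>M\<^esub> fst x, a \<odot>\<^bsub>N\<^esub> snd x))\<rparr>"

lemma direct_sum_simps [simp]:
  "carrier (direct_sum M N) = carrier M \<times> carrier N"
  "\<zero>\<^bsub>direct_sum M N\<^esub> = (\<zero>\<^bsub>M\<^esub>, \<zero>\<^bsub>N\<^esub>)"
  "(x, y) \<oplus>\<^bsub>direct_sum M N\<^esub> (x', y') = (x \<oplus>\<^bsub>M\<^esub> x', y \<oplus>\<^bsub>N\<^esub> y')"
  "a \<odot>\<^bsub>direct_sum M N\<^esub> (x, y) = (a \<odot>\<^bsub>M\<^esub> x, a \<odot>\<^bsub>N\<^esub> y)"
  by (simp_all add: direct_sum_def)

lemma left_module_direct_sum:
  assumes "left_module R M" "left_module R N"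
  shows "left_module R (direct_sum M N)"
proof -
  interpret M: left_module R M by fact
  interpret N: left_module R N by fact
  have "abelian_group (direct_sum M N)"
  proof (rule abelian_groupI)
    fix x assume "x \<in> carrier (direct_sum M N)"
    then show "\<exists>y\<in>carrier (direct_sum M N). y \<oplus>\<^bsub>direct_sum M N\<^esub> x = \<zero>\<^bsub>direct_sum M N\<^esub>"
      by (intro bexI[of _ "(\<ominus>\<^bsub>M\<^esub> fst x, \<ominus>\<^bsub>N\<^esub> snd x)"]) (auto simp: M.M.l_neg N.M.l_neg)
  qed (auto simp: M.M.a_ac N.M.a_ac)
  then show ?thesis
    by (intro left_module.intro left_module_axioms.intro M.R.ring_axioms)
      (auto simp: M.smult_closed M.smult_l_distr M.smult_r_distr M.smult_assoc1 M.smult_one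
        N.smult_closed N.smult_l_distr N.smult_r_distr N.smult_assoc1 N.smult_one)
qed

text \<open>\<open>left_hom\<close> has no clause for zero; compatibility with scalars supplies it,
  since the zero of a module is the zero scalar times itself.\<close>

lemma left_hom_zero:
  assumes "left_module R M" "left_module R N" "f \<in> left_hom R M N"
  shows "f \<zero>\<^bsub>M\<^esub> = \<zero>\<^bsub>N\<^esub>"
proof -
  interpret M: left_module R M by fact
  interpret N: left_module R N by fact
  have c: "f \<zero>\<^bsub>M\<^esub> \<in> carrier N" using assms(3) by (auto simp: left_hom_def)
  have "f (\<zero>\<^bsub>R\<^esub> \<odot>\<^bsub>M\<^esub> \<zero>\<^bsub>M\<^esub>) = \<zero>\<^bsub>R\<^esub> \<odot>\<^bsub>N\<^esub> f \<zero>\<^bsub>M\<^esub>"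
    using assms(3) by (simp add: left_hom_def)
  then show ?thesis using c by (simp add: M.smult_l_null N.smult_l_null)
qed

lemma left_submodule_hom:
  "left_submodule R N M \<Longrightarrow> (\<lambda>x. x) \<in> left_hom R N M"
  by (auto simp: left_submodule_def left_hom_def)

text \<open>\<open>left_submodule\<close> compares only carriers, addition and scalars; the zeros
  agree because the inclusion is a homomorphism.\<close>

lemma left_submodule_zero:
  assumes "left_submodule R N M"
  shows "\<zero>\<^bsub>N\<^esub> = \<zero>\<^bsub>M\<^esub>"
  using left_hom_zero[OF _ _ left_submodule_hom[OF assms]] assms by (simp add: left_submodule_def)

lemma left_hom_comp:
  "\<lbrakk>f \<in> left_hom R M N; g \<in> left_hom R N P\<rbrakk> \<Longrightarrow> g \<circ> f \<in> left_hom R M P"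
  by (auto simp: left_hom_def Pi_iff)

text \<open>The pushout of the inclusion \<open>S\<close> into \<open>P\<close> and of
  \<open>f\<close> is a quotient of the direct sum of \<open>P\<close> and \<open>N\<close>, which
  bounds its cardinality. The map \<open>g\<close> from \<open>N\<close> is injective because the
  opposite side of the square, the inclusion of \<open>S\<close>, is.\<close>

lemma pushout_exists:
  fixes S P :: "('a, 'p) module" and N :: "('a, 'n) module"
  assumes S: "left_submodule R S P" and N: "left_module R N" and f: "f \<in> left_hom R S N"
  shows "\<exists>(Q :: ('a, 'p \<times> 'n) module) g h. left_module R Q \<and>
    g \<in> left_embedding R N Q \<and> h \<in> left_hom R P Q \<and> (\<forall>x\<in>carrier S. h x = g (f x)) \<and>
    |carrier Q| \<le>o |carrier P \<times> carrier N|"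
proof -
  have SP: "left_module R S" "left_module R P" using S by (auto simp: left_submodule_def)
  interpret S: left_module R S by (rule SP)
  interpret P: left_module R P by (rule SP)
  interpret N: left_module R N by fact
  interpret D: left_module R "direct_sum P N" using SP N by (simp add: left_module_direct_sum)
  have S_sub: "carrier S \<subseteq> carrier P"
    and S_add: "\<And>x y. \<lbrakk>x \<in> carrier S; y \<in> carrier S\<rbrakk> \<Longrightarrow> x \<oplus>\<^bsub>P\<^esub> y = x \<oplus>\<^bsub>S\<^esub> y"
    and S_smult: "\<And>a x. \<lbrakk>a \<in> carrier R; x \<in> carrier S\<rbrakk> \<Longrightarrow> a \<odot>\<^bsub>P\<^esub> x = a \<odot>\<^bsub>S\<^esub> x"
    using S by (auto simp: left_submodule_def)
  have f_closed: "\<And>x. x \<in> carrier S \<Longrightarrow> f x \<in> carrier N"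
    and f_add: "\<And>x y. \<lbrakk>x \<in> carrier S; y \<in> carrier S\<rbrakk> \<Longrightarrow> f (x \<oplus>\<^bsub>S\<^esub> y) = f x \<oplus>\<^bsub>N\<^esub> f y"
    and f_smult: "\<And>a x. \<lbrakk>a \<in> carrier R; x \<in> carrier S\<rbrakk> \<Longrightarrow> f (a \<odot>\<^bsub>S\<^esub> x) = a \<odot>\<^bsub>N\<^esub> f x"
    using f by (auto simp: left_hom_def)
  have f_zero: "f \<zero>\<^bsub>S\<^esub> = \<zero>\<^bsub>N\<^esub>" by (rule left_hom_zero[OF SP(1) N f])
  have S_zero: "\<zero>\<^bsub>P\<^esub> = \<zero>\<^bsub>S\<^esub>" by (simp add: left_submodule_zero[OF S])
  have D_diff: "(x, y) \<ominus>\<^bsub>direct_sum P N\<^esub> (x', y') = (x \<ominus>\<^bsub>P\<^esub> x', y \<ominus>\<^bsub>N\<^esub> y')"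
    if "x \<in> carrier P" "x' \<in> carrier P" "y \<in> carrier N" "y' \<in> carrier N" for x x' y y'
  proof -
    have "\<ominus>\<^bsub>direct_sum P N\<^esub> (x', y') = (\<ominus>\<^bsub>P\<^esub> x', \<ominus>\<^bsub>N\<^esub> y')"
      using that by (intro D.M.minus_equality) (simp_all add: P.M.l_neg N.M.l_neg)
    then show ?thesis by (simp add: D.M.minus_eq P.M.minus_eq N.M.minus_eq)
  qed
  \<comment> \<open>Dividing by the pairs \<open>(s, - f s)\<close> identifies \<open>(s, 0)\<close>
    with \<open>(0, f s)\<close>, which makes the square commute.\<close>
  define K where "K = (\<lambda>x. (x, \<ominus>\<^bsub>N\<^esub> f x)) ` carrier S"
  have "\<exists>(Q :: ('a, 'p \<times> 'n) module) q. left_module R Q \<and> q \<in> left_hom R (direct_sum P N) Q \<and>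
    q ` carrier (direct_sum P N) = carrier Q \<and>
    (\<forall>x\<in>carrier (direct_sum P N). \<forall>y\<in>carrier (direct_sum P N).
       q x = q y \<longleftrightarrow> x \<ominus>\<^bsub>direct_sum P N\<^esub> y \<in> K)"
  proof (rule D.quotient_exists)
    show "K \<subseteq> carrier (direct_sum P N)" using S_sub f_closed by (auto simp: K_def)
    show "\<zero>\<^bsub>direct_sum P N\<^esub> \<in> K"
      unfolding K_def by (rule image_eqI[of _ _ "\<zero>\<^bsub>S\<^esub>"]) (simp_all add: f_zero S_zero N.M.neg_zero)
    show "x \<oplus>\<^bsub>direct_sum P N\<^esub> y \<in> K" if xy: "x \<in> K" "y \<in> K" for x y
    proof -
      obtain s t where "s \<in> carrier S" "t \<in> carrier S" "x = (s, \<ominus>\<^bsub>N\<^esub> f s)" "y = (t, \<ominus>\<^bsub>N\<^esub> f t)"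
        using xy by (auto simp: K_def)
      then show ?thesis unfolding K_def
        by (intro image_eqI[of _ _ "s \<oplus>\<^bsub>S\<^esub> t"])
          (simp_all add: S_add f_add f_closed N.M.minus_add)
    qed
    show "a \<odot>\<^bsub>direct_sum P N\<^esub> x \<in> K" if ax: "a \<in> carrier R" "x \<in> K" for a x
    proof -
      obtain s where "s \<in> carrier S" "x = (s, \<ominus>\<^bsub>N\<^esub> f s)" using ax by (auto simp: K_def)
      then show ?thesis unfolding K_def using ax
        by (intro image_eqI[of _ _ "a \<odot>\<^bsub>S\<^esub> s"])
          (simp_all add: S_smult f_smult f_closed N.smult_r_minus S.smult_closed)
    qed
  qed
  then obtain Q :: "('a, 'p \<times> 'n) module" and q where Q: "left_module R Q"
    and q: "q \<in> left_hom R (direct_sum P N) Q" "q ` (carrier P \<times> carrier N) = carrier Q"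
    and q_eq: "\<And>x y. \<lbrakk>x \<in> carrier P \<times> carrier N; y \<in> carrier P \<times> carrier N\<rbrakk> \<Longrightarrow>
      q x = q y \<longleftrightarrow> x \<ominus>\<^bsub>direct_sum P N\<^esub> y \<in> K"
    by auto
  define g where "g y = q (\<zero>\<^bsub>P\<^esub>, y)" for y
  define h where "h x = q (x, \<zero>\<^bsub>N\<^esub>)" for x
  have "g = q \<circ> Pair \<zero>\<^bsub>P\<^esub>" "h = q \<circ> (\<lambda>x. (x, \<zero>\<^bsub>N\<^esub>))" by (auto simp: g_def h_def)
  moreover have "Pair \<zero>\<^bsub>P\<^esub> \<in> left_hom R N (direct_sum P N)"
    "(\<lambda>x. (x, \<zero>\<^bsub>N\<^esub>)) \<in> left_hom R P (direct_sum P N)"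
    by (auto simp: left_hom_def P.smult_r_null N.smult_r_null)
  ultimately have g: "g \<in> left_hom R N Q" and h: "h \<in> left_hom R P Q"
    using left_hom_comp[OF _ q(1)] by blast+
  \<comment> \<open>If \<open>g y = g y'\<close>, then \<open>(0, y - y')\<close> is some
    \<open>(s, - f s)\<close>. The first coordinate forces \<open>s = 0\<close>, so
    \<open>y - y' = - f 0 = 0\<close>.\<close>
  have "inj_on g (carrier N)"
  proof (rule inj_onI)
    fix y y' assume y: "y \<in> carrier N" "y' \<in> carrier N" "g y = g y'"
    then have "(\<zero>\<^bsub>P\<^esub> \<ominus>\<^bsub>P\<^esub> \<zero>\<^bsub>P\<^esub>, y \<ominus>\<^bsub>N\<^esub> y') \<in> K"
      by (simp add: g_def q_eq D_diff)
    then have "y \<ominus>\<^bsub>N\<^esub> y' = \<zero>\<^bsub>N\<^esub>"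
      using P.M.zero_closed by (auto simp: K_def P.M.minus_eq P.M.r_neg S_zero f_zero N.M.neg_zero)
    then show "y = y'" using y N.M.diff_eq_zeroD by blast
  qed
  moreover have "h x = g (f x)" if "x \<in> carrier S" for x
  proof -
    have "(x \<ominus>\<^bsub>P\<^esub> \<zero>\<^bsub>P\<^esub>, \<zero>\<^bsub>N\<^esub> \<ominus>\<^bsub>N\<^esub> f x) \<in> K"
      using that S_sub f_closed
      by (auto simp: K_def P.M.minus_eq N.M.minus_eq intro!: image_eqI[of _ _ x])
    then show ?thesis
      using that S_sub f_closed by (simp add: g_def h_def q_eq D_diff subset_iff)
  qed
  ultimately show ?thesis
    using Q g h card_of_image[of q "carrier P \<times> carrier N"] q(2)
    by (intro exI[of _ Q] exI[of _ g] exI[of _ h]) (simp add: left_embedding_def)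
qed

text \<open>Universality turns into an extension property: the pushout of \<open>f\<close> along
  \<open>S\<close> in \<open>P\<close> is an extension of \<open>N\<close> of the same cardinality,
  so it embeds into \<open>M\<close> over \<open>N\<close>, and \<open>P\<close> maps into the
  pushout.\<close>

lemma universal_over_extends:
  fixes S P :: "('a, 'p) module" and M N :: "('a, 'n) module"
  assumes univ: "universal_over R M N" and inf: "infinite (carrier N)"
    and S: "left_submodule R S P" and card: "|carrier P| \<le>o |carrier N|"
    and f: "f \<in> left_hom R S N"
  shows "\<exists>g \<in> left_hom R P M. \<forall>x\<in>carrier S. g x = f x"
proof -
  have NM: "|carrier M| =o |carrier N|" "left_submodule R N M"
    using univ by (auto simp: universal_over_def)
  then have N: "left_module R N" by (simp add: left_submodule_def)
  interpret P: left_module R P using S by (simp add: left_submodule_def)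
  obtain Q :: "('a, 'p \<times> 'n) module" and g h where Q: "left_module R Q"
    and g: "g \<in> left_embedding R N Q" and h: "h \<in> left_hom R P Q"
    and hg: "\<forall>x\<in>carrier S. h x = g (f x)" and cQ: "|carrier Q| \<le>o |carrier P \<times> carrier N|"
    using pushout_exists[OF S N f] by blast
  \<comment> \<open>An infinite cardinal absorbs a nonempty factor that is not larger;
    \<open>P\<close> is nonempty because it contains zero.\<close>
  have "|carrier P \<times> carrier N| =o |carrier N|"
    using card_of_Times_infinite[OF inf _ card] P.M.zero_closed by blast
  then have "|carrier Q| \<le>o |carrier N|" using cQ ordLeq_ordIso_trans by blast
  moreover have "|carrier N| \<le>o |carrier Q|"
    using g by (intro card_of_ordLeqI[of g]) (auto simp: left_embedding_def left_hom_def)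
  ultimately have "|carrier Q| =o |carrier M|"
    using NM(1) by (meson ordIso_iff_ordLeq ordIso_symmetric ordIso_transitive)
  \<comment> \<open>The pushout lives in the type \<open>'p \<times> 'n\<close>, so universality is
    needed in its form for arbitrary types.\<close>
  then obtain e where e: "e \<in> left_embedding R Q M" "\<forall>x\<in>carrier N. e (g x) = x"
    using universal_over_all_types[OF univ Q _ g] by blast
  have "e \<circ> h \<in> left_hom R P M"
    using left_hom_comp[OF h] e(1) by (auto simp: left_embedding_def)
  moreover have "(e \<circ> h) x = f x" if "x \<in> carrier S" for x
    using that hg e(2) f by (auto simp: left_hom_def)
  ultimately show ?thesis by blast
qed


section \<open>Baer's criterion\<close>

text \<open>The graph of a partial homomorphism from \<open>B\<close> to \<open>M\<close>. As sets
  of pairs, partial homomorphisms are ordered by inclusion, ready for Zorn's lemma. Uniqueness of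
  values is demanded at zero only; elsewhere it follows by subtracting pairs. The empty set
  qualifies, so \<open>(0, 0)\<close> has to be supplied separately where it matters.\<close>

definition linear_graph ::
    "('a, 'r) ring_scheme \<Rightarrow> ('a, 'b) module \<Rightarrow> ('a, 'c) module \<Rightarrow> ('b \<times> 'c) set \<Rightarrow> bool" where
  "linear_graph R B M G \<longleftrightarrow>
     G \<subseteq> carrier B \<times> carrier M \<and>
     (\<forall>x y x' y'. (x, y) \<in> G \<and> (x', y') \<in> G \<longrightarrow> (x \<oplus>\<^bsub>B\<^esub> x', y \<oplus>\<^bsub>M\<^esub> y') \<in> G) \<and>
     (\<forall>a\<in>carrier R. \<forall>x y. (x, y) \<in> G \<longrightarrow> (a \<odot>\<^bsub>B\<^esub> x, a \<odot>\<^bsub>M\<^esub> y) \<in> G) \<and>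
     (\<forall>y. (\<zero>\<^bsub>B\<^esub>, y) \<in> G \<longrightarrow> y = \<zero>\<^bsub>M\<^esub>)"

lemma linear_graphD:
  assumes "linear_graph R B M G"
  shows "(x, y) \<in> G \<Longrightarrow> x \<in> carrier B" "(x, y) \<in> G \<Longrightarrow> y \<in> carrier M"
    "\<lbrakk>(x, y) \<in> G; (x', y') \<in> G\<rbrakk> \<Longrightarrow> (x \<oplus>\<^bsub>B\<^esub> x', y \<oplus>\<^bsub>M\<^esub> y') \<in> G"
    "\<lbrakk>a \<in> carrier R; (x, y) \<in> G\<rbrakk> \<Longrightarrow> (a \<odot>\<^bsub>B\<^esub> x, a \<odot>\<^bsub>M\<^esub> y) \<in> G"
    "(\<zero>\<^bsub>B\<^esub>, y) \<in> G \<Longrightarrow> y = \<zero>\<^bsub>M\<^esub>"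
  using assms unfolding linear_graph_def by blast+

lemma linear_graph_single_valued:
  assumes "left_module R B" "left_module R M" "linear_graph R B M G"
    and "(x, y) \<in> G" "(x, y') \<in> G"
  shows "y = y'"
proof -
  interpret B: left_module R B by fact
  interpret M: left_module R M by fact
  note G = linear_graphD[OF assms(3)]
  have c: "x \<in> carrier B" "y \<in> carrier M" "y' \<in> carrier M" using G(1,2) assms(4,5) by auto
  have "((\<ominus>\<^bsub>R\<^esub> \<one>\<^bsub>R\<^esub>) \<odot>\<^bsub>B\<^esub> x, (\<ominus>\<^bsub>R\<^esub> \<one>\<^bsub>R\<^esub>) \<odot>\<^bsub>M\<^esub> y') \<in> G"
    using G(4) assms(5) by simp
  then have "(x \<oplus>\<^bsub>B\<^esub> \<ominus>\<^bsub>B\<^esub> x, y \<oplus>\<^bsub>M\<^esub> \<ominus>\<^bsub>M\<^esub> y') \<in> G"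
    using c G(3)[OF assms(4)] by (simp add: B.minus_smult_one M.minus_smult_one)
  then have "y \<ominus>\<^bsub>M\<^esub> y' = \<zero>\<^bsub>M\<^esub>"
    using c G(5) by (simp add: B.M.r_neg M.M.minus_eq)
  then show ?thesis using c M.M.diff_eq_zeroD by blast
qed

lemma linear_graph_Union:
  assumes "subset.chain {G. linear_graph R B M G} \<C>"
  shows "linear_graph R B M (\<Union>\<C>)"
proof -
  have lin: "\<And>G. G \<in> \<C> \<Longrightarrow> linear_graph R B M G"
    and chain: "\<And>G H. \<lbrakk>G \<in> \<C>; H \<in> \<C>\<rbrakk> \<Longrightarrow> G \<subseteq> H \<or> H \<subseteq> G"
    using assms by (auto simp: subset_chain_def)
  note G = linear_graphD[OF lin]
  show ?thesis
    unfolding linear_graph_def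
  proof (intro conjI allI impI ballI)
    show "\<Union>\<C> \<subseteq> carrier B \<times> carrier M" using G(1,2) by auto
    fix x y x' y' assume "(x, y) \<in> \<Union>\<C> \<and> (x', y') \<in> \<Union>\<C>"
    then obtain K L where "K \<in> \<C>" "(x, y) \<in> K" "L \<in> \<C>" "(x', y') \<in> L" by blast
    \<comment> \<open>Of two members of a chain the larger one contains both pairs, and it is closed
      under addition.\<close>
    then obtain H where "H \<in> \<C>" "(x, y) \<in> H" "(x', y') \<in> H" using chain by blast
    then show "(x \<oplus>\<^bsub>B\<^esub> x', y \<oplus>\<^bsub>M\<^esub> y') \<in> \<Union>\<C>" using G(3) by blast
  next
    fix a x y assume "a \<in> carrier R" "(x, y) \<in> \<Union>\<C>"
    then show "(a \<odot>\<^bsub>B\<^esub> x, a \<odot>\<^bsub>M\<^esub> y) \<in> \<Union>\<C>" using G(4) by blast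
  next
    fix y assume "(\<zero>\<^bsub>B\<^esub>, y) \<in> \<Union>\<C>"
    then show "y = \<zero>\<^bsub>M\<^esub>" using G(5) by blast
  qed
qed

section \<open>Left ideals as modules\<close>

lemma ideal_module_simps [simp]:
  "carrier (ideal_module R I) = I" "x \<oplus>\<^bsub>ideal_module R I\<^esub> y = x \<oplus>\<^bsub>R\<^esub> y"
  "a \<odot>\<^bsub>ideal_module R I\<^esub> x = a \<otimes>\<^bsub>R\<^esub> x" "\<zero>\<^bsub>ideal_module R I\<^esub> = \<zero>\<^bsub>R\<^esub>"
  by (simp_all add: ideal_module_def)

lemma (in ring) left_ideal_carrier: "left_ideal R (carrier R)"
  unfolding left_ideal_def additive_subgroup_def
  using add.subgroup_self by simp

lemma (in ring) left_idealI:
  assumes "I \<subseteq> carrier R" "\<zero> \<in> I" "\<And>x y. \<lbrakk>x \<in> I; y \<in> I\<rbrakk> \<Longrightarrow> x \<oplus> y \<in> I"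
    and smult: "\<And>a x. \<lbrakk>a \<in> carrier R; x \<in> I\<rbrakk> \<Longrightarrow> a \<otimes> x \<in> I"
  shows "left_ideal R I"
proof -
  \<comment> \<open>Negation is left multiplication by \<open>- 1\<close>.\<close>
  have "\<ominus> x \<in> I" if "x \<in> I" for x
    using smult[of "\<ominus> \<one>" x] that assms(1) by (auto simp: l_minus)
  then show ?thesis
    unfolding left_ideal_def additive_subgroup_def
    using assms by (auto intro!: add.subgroupI simp: a_inv_def)
qed

lemma (in ring) left_ideal_submodule:
  assumes "left_ideal R I"
  shows "left_submodule R (ideal_module R I) (ideal_module R (carrier R))"
proof -
  have *: "left_module R (ideal_module R J)" if J: "left_ideal R J" for J
  proof -
    interpret J: additive_subgroup J R using J by (simp add: left_ideal_def)
    have "abelian_group (ideal_module R J)"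
    proof (rule abelian_groupI)
      fix x assume "x \<in> carrier (ideal_module R J)"
      then show "\<exists>y\<in>carrier (ideal_module R J). y \<oplus>\<^bsub>ideal_module R J\<^esub> x = \<zero>\<^bsub>ideal_module R J\<^esub>"
        by (intro bexI[of _ "\<ominus> x"]) (simp_all add: J.a_Hcarr l_neg)
    qed (simp_all add: J.a_Hcarr a_ac)
    then show ?thesis
      using J by (intro left_module.intro left_module_axioms.intro ring_axioms)
        (simp_all add: J.a_Hcarr l_distr r_distr m_assoc left_ideal_def)
  qed
  have "I \<subseteq> carrier R" using assms by (auto simp: left_ideal_def dest: additive_subgroup.a_subset)
  then show ?thesis
    using *[OF assms] *[OF left_ideal_carrier] by (simp add: left_submodule_def)
qed

text \<open>One step of Baer's argument: a partial homomorphism can be extended to one more element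
  \<open>b\<close>. The scalars \<open>r\<close> for which \<open>r b\<close> already lies in the
  domain of \<open>G\<close> form a left ideal \<open>I\<close>, and extending the induced map on
  \<open>I\<close> to all of \<open>R\<close> shows which value \<open>m\<close> to give to
  \<open>b\<close>.\<close>

lemma linear_graph_extend:
  fixes B :: "('a, 'c) module" and M :: "('a, 'b) module"
  assumes B: "left_module R B" and M: "left_module R M"
    and ext: "\<And>I f. \<lbrakk>left_ideal R I; f \<in> left_hom R (ideal_module R I) M\<rbrakk> \<Longrightarrow>
      \<exists>g \<in> left_hom R (ideal_module R (carrier R)) M. \<forall>x\<in>I. g x = f x"
    and G: "linear_graph R B M G" and ne: "(\<zero>\<^bsub>B\<^esub>, \<zero>\<^bsub>M\<^esub>) \<in> G" and b: "b \<in> carrier B"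
  shows "\<exists>m G'. linear_graph R B M G' \<and> G \<subseteq> G' \<and> (b, m) \<in> G'"
proof -
  interpret B: left_module R B by fact
  interpret M: left_module R M by fact
  note Gd = linear_graphD[OF G]
  note sv = linear_graph_single_valued[OF B M G]
  define I where "I = {r \<in> carrier R. \<exists>y. (r \<odot>\<^bsub>B\<^esub> b, y) \<in> G}"
  define f where "f r = (SOME y. (r \<odot>\<^bsub>B\<^esub> b, y) \<in> G)" for r
  have I: "left_ideal R I"
  proof (rule B.R.left_idealI)
    show "I \<subseteq> carrier R" "\<zero>\<^bsub>R\<^esub> \<in> I" using ne b by (auto simp: I_def B.smult_l_null)
    show "x \<oplus>\<^bsub>R\<^esub> y \<in> I" if "x \<in> I" "y \<in> I" for x y
      using that Gd(3) b by (auto simp: I_def B.smult_l_distr) blast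
    show "a \<otimes>\<^bsub>R\<^esub> x \<in> I" if "a \<in> carrier R" "x \<in> I" for a x
      using that Gd(4) b by (auto simp: I_def B.smult_assoc1)
  qed
  have f: "(r \<odot>\<^bsub>B\<^esub> b, f r) \<in> G" if "r \<in> I" for r
    using that unfolding f_def I_def by (auto intro: someI)
  \<comment> \<open>By single-valuedness any pair of \<open>G\<close> over \<open>r b\<close>
    computes \<open>f r\<close>, so the closure properties of \<open>G\<close> become the
    homomorphism laws of \<open>f\<close>.\<close>
  have f_eq: "f r = y" if "(r \<odot>\<^bsub>B\<^esub> b, y) \<in> G" for r y
    using that unfolding f_def by (rule someI2) (use sv that in blast)
  have "f \<in> left_hom R (ideal_module R I) M"
    unfolding left_hom_def
  proof (intro CollectI conjI ballI)
    show "f \<in> carrier (ideal_module R I) \<rightarrow> carrier M" using f Gd(2) by auto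
    fix x y assume "x \<in> carrier (ideal_module R I)" "y \<in> carrier (ideal_module R I)"
    then have xy: "x \<in> I" "y \<in> I" "x \<in> carrier R" "y \<in> carrier R" by (auto simp: I_def)
    then show "f (x \<oplus>\<^bsub>ideal_module R I\<^esub> y) = f x \<oplus>\<^bsub>M\<^esub> f y"
      using Gd(3)[OF f f] b by (simp add: f_eq B.smult_l_distr)
  next
    fix a x assume "a \<in> carrier R" "x \<in> carrier (ideal_module R I)"
    moreover from this have "x \<in> I" "x \<in> carrier R" by (auto simp: I_def)
    ultimately show "f (a \<odot>\<^bsub>ideal_module R I\<^esub> x) = a \<odot>\<^bsub>M\<^esub> f x"
      using Gd(4)[OF _ f] b by (simp add: f_eq B.smult_assoc1)
  qed
  then obtain g where g: "g \<in> left_hom R (ideal_module R (carrier R)) M" "\<forall>x\<in>I. g x = f x"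
    using ext I by blast
  define m where "m = g \<one>\<^bsub>R\<^esub>"
  have m: "m \<in> carrier M" using g(1) by (auto simp: m_def left_hom_def)
  \<comment> \<open>A homomorphism out of \<open>R\<close> is determined by its value at one. The
    rule \<open>r_one\<close> is disabled so that the product with one survives until the scalar law
    has been applied.\<close>
  have gm: "g r = r \<odot>\<^bsub>M\<^esub> m" if r: "r \<in> carrier R" for r
  proof -
    have "g (r \<otimes>\<^bsub>R\<^esub> \<one>\<^bsub>R\<^esub>) = r \<odot>\<^bsub>M\<^esub> g \<one>\<^bsub>R\<^esub>"
      using g(1) r B.R.one_closed unfolding left_hom_def by (simp del: B.R.r_one)
    then show ?thesis using r by (simp add: m_def)
  qed
  \<comment> \<open>\<open>G'\<close> is the sum of \<open>G\<close> and the multiples of the single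
    pair \<open>(b, m)\<close>.\<close>
  define G' where "G' = {(x \<oplus>\<^bsub>B\<^esub> r \<odot>\<^bsub>B\<^esub> b, y \<oplus>\<^bsub>M\<^esub> r \<odot>\<^bsub>M\<^esub> m) | x y r. (x, y) \<in> G \<and> r \<in> carrier R}"
  have G'I: "(u, v) \<in> G'"
    if "(x, y) \<in> G" "r \<in> carrier R" "u = x \<oplus>\<^bsub>B\<^esub> r \<odot>\<^bsub>B\<^esub> b" "v = y \<oplus>\<^bsub>M\<^esub> r \<odot>\<^bsub>M\<^esub> m" for x y r u v
    using that unfolding G'_def by blast
  have "linear_graph R B M G'"
    unfolding linear_graph_def
  proof (intro conjI allI impI ballI)
    show "G' \<subseteq> carrier B \<times> carrier M"
      using Gd(1,2) b m by (auto simp: G'_def B.smult_closed M.smult_closed)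
  next
    fix u v u' v' assume "(u, v) \<in> G' \<and> (u', v') \<in> G'"
    then obtain x y r x' y' r' where *: "(x, y) \<in> G" "r \<in> carrier R" "(x', y') \<in> G" "r' \<in> carrier R"
      and uv: "u = x \<oplus>\<^bsub>B\<^esub> r \<odot>\<^bsub>B\<^esub> b" "v = y \<oplus>\<^bsub>M\<^esub> r \<odot>\<^bsub>M\<^esub> m"
        "u' = x' \<oplus>\<^bsub>B\<^esub> r' \<odot>\<^bsub>B\<^esub> b" "v' = y' \<oplus>\<^bsub>M\<^esub> r' \<odot>\<^bsub>M\<^esub> m"
      unfolding G'_def by blast
    have c: "x \<in> carrier B" "x' \<in> carrier B" "y \<in> carrier M" "y' \<in> carrier M"
      using Gd(1,2) * by auto
    show "(u \<oplus>\<^bsub>B\<^esub> u', v \<oplus>\<^bsub>M\<^esub> v') \<in> G'"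
      using c * b m
      by (intro G'I[OF Gd(3)[OF *(1,3)], of "r \<oplus>\<^bsub>R\<^esub> r'"])
        (simp_all add: uv B.smult_l_distr M.smult_l_distr B.smult_closed M.smult_closed
          B.M.a_ac M.M.a_ac)
  next
    fix a u v assume a: "a \<in> carrier R" and "(u, v) \<in> G'"
    then obtain x y r where *: "(x, y) \<in> G" "r \<in> carrier R"
      and uv: "u = x \<oplus>\<^bsub>B\<^esub> r \<odot>\<^bsub>B\<^esub> b" "v = y \<oplus>\<^bsub>M\<^esub> r \<odot>\<^bsub>M\<^esub> m"
      unfolding G'_def by blast
    have c: "x \<in> carrier B" "y \<in> carrier M" using Gd(1,2) * by auto
    show "(a \<odot>\<^bsub>B\<^esub> u, a \<odot>\<^bsub>M\<^esub> v) \<in> G'"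
      using a c * b m
      by (intro G'I[OF Gd(4)[OF a *(1)], of "a \<otimes>\<^bsub>R\<^esub> r"])
        (simp_all add: uv B.smult_r_distr M.smult_r_distr B.smult_closed M.smult_closed
          B.smult_assoc1 M.smult_assoc1)
  next
    fix v assume "(\<zero>\<^bsub>B\<^esub>, v) \<in> G'"
    then obtain x y r where *: "(x, y) \<in> G" "r \<in> carrier R"
      and x: "x \<oplus>\<^bsub>B\<^esub> r \<odot>\<^bsub>B\<^esub> b = \<zero>\<^bsub>B\<^esub>" and v: "v = y \<oplus>\<^bsub>M\<^esub> r \<odot>\<^bsub>M\<^esub> m"
      unfolding G'_def by (auto simp: eq_commute)
    have c: "x \<in> carrier B" "y \<in> carrier M" using Gd(1,2) * by auto
    \<comment> \<open>This is where the choice of \<open>m\<close> pays off. From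
      \<open>x + r b = 0\<close> it follows that \<open>r b = - x\<close> is in the domain of
      \<open>G\<close> with value \<open>- y\<close>, so \<open>r\<close> is in \<open>I\<close> and
      \<open>r m = g r = f r = - y\<close>.\<close>
    have "r \<odot>\<^bsub>B\<^esub> b = \<ominus>\<^bsub>B\<^esub> x"
      using x c b * B.M.minus_equality[of "r \<odot>\<^bsub>B\<^esub> b" x] by (simp add: B.smult_closed B.M.a_comm)
    then have "(r \<odot>\<^bsub>B\<^esub> b, \<ominus>\<^bsub>M\<^esub> y) \<in> G"
      using Gd(4)[OF _ *(1), of "\<ominus>\<^bsub>R\<^esub> \<one>\<^bsub>R\<^esub>"] c by (simp add: B.minus_smult_one M.minus_smult_one)
    then have "r \<in> I" "f r = \<ominus>\<^bsub>M\<^esub> y" using *(2) by (auto simp: I_def f_eq)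
    then have "r \<odot>\<^bsub>M\<^esub> m = \<ominus>\<^bsub>M\<^esub> y" using g(2) gm[OF *(2)] by simp
    then show "v = \<zero>\<^bsub>M\<^esub>" using c by (simp add: v M.M.r_neg)
  qed
  moreover have "G \<subseteq> G'"
  proof (rule subrelI)
    fix x y assume xy: "(x, y) \<in> G"
    then show "(x, y) \<in> G'"
      using Gd(1,2)[OF xy] b m
      by (intro G'I[OF xy B.R.zero_closed]) (simp_all add: B.smult_l_null M.smult_l_null)
  qed
  moreover have "(b, m) \<in> G'"
    \<comment> \<open>The pair comes from \<open>(0, 0)\<close> in \<open>G\<close> and the scalar
      one; the inclusion of \<open>G\<close> above used the scalar zero.\<close>
    using b m by (intro G'I[OF ne B.R.one_closed]) (simp_all add: B.smult_one M.smult_one)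
  ultimately show ?thesis by blast
qed

text \<open>Zorn's lemma yields a maximal partial homomorphism extending \<open>f\<close>, and
  \<open>linear_graph_extend\<close> shows that its domain is all of \<open>B\<close>.\<close>

theorem Baer_criterion:
  fixes M :: "('a, 'b) module"
  assumes M: "left_module R M"
    and ext: "\<And>I f. \<lbrakk>left_ideal R I; f \<in> left_hom R (ideal_module R I) M\<rbrakk> \<Longrightarrow>
      \<exists>g \<in> left_hom R (ideal_module R (carrier R)) M. \<forall>x\<in>I. g x = f x"
  shows "left_injective TYPE('c) R M"
  unfolding left_injective_def
proof (intro conjI M allI impI ballI)
  fix A B :: "('a, 'c) module" and f
  assume AB: "left_submodule R A B" and f: "f \<in> left_hom R A M"
  have A: "left_module R A" and B: "left_module R B" using AB by (auto simp: left_submodule_def)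
  interpret A: left_module R A by (rule A)
  interpret B: left_module R B by (rule B)
  define F where "F = (\<lambda>x. (x, f x)) ` carrier A"
  have zero: "(\<zero>\<^bsub>B\<^esub>, \<zero>\<^bsub>M\<^esub>) \<in> F"
    using left_hom_zero[OF A M f] left_submodule_zero[OF AB] A.M.zero_closed
    by (metis F_def image_eqI)
  have F: "linear_graph R B M F"
    unfolding linear_graph_def
  proof (intro conjI allI impI ballI)
    show "F \<subseteq> carrier B \<times> carrier M"
      using AB f by (auto simp: F_def left_submodule_def left_hom_def)
  next
    fix x y x' y' assume "(x, y) \<in> F \<and> (x', y') \<in> F"
    then show "(x \<oplus>\<^bsub>B\<^esub> x', y \<oplus>\<^bsub>M\<^esub> y') \<in> F"
      using AB f unfolding F_def
      by (intro image_eqI[of _ _ "x \<oplus>\<^bsub>A\<^esub> x'"]) (auto simp: left_submodule_def left_hom_def)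
  next
    fix a x y assume "a \<in> carrier R" "(x, y) \<in> F"
    then show "(a \<odot>\<^bsub>B\<^esub> x, a \<odot>\<^bsub>M\<^esub> y) \<in> F"
      using AB f unfolding F_def
      by (intro image_eqI[of _ _ "a \<odot>\<^bsub>A\<^esub> x"])
        (auto simp: left_submodule_def left_hom_def A.smult_closed)
  next
    fix y assume "(\<zero>\<^bsub>B\<^esub>, y) \<in> F"
    then show "y = \<zero>\<^bsub>M\<^esub>"
      using left_hom_zero[OF A M f] left_submodule_zero[OF AB] by (auto simp: F_def)
  qed
  let ?S = "{G. linear_graph R B M G \<and> F \<subseteq> G}"
  have "\<exists>G\<in>?S. \<forall>X\<in>?S. G \<subseteq> X \<longrightarrow> X = G"
  proof (rule subset_Zorn_nonempty)
    show "?S \<noteq> {}" using F by blast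
    \<comment> \<open>The chain is nonempty, so one of its members, and hence its union, contains
      \<open>F\<close>.\<close>
    fix \<C> assume "\<C> \<noteq> {}" "subset.chain ?S \<C>"
    then have "subset.chain {G. linear_graph R B M G} \<C>" "\<exists>G\<in>\<C>. F \<subseteq> G"
      by (auto simp: subset_chain_def)
    then show "\<Union>\<C> \<in> ?S"
      using linear_graph_Union[of R B M \<C>] by blast
  qed
  then obtain G where G_S: "G \<in> ?S" and G_max: "\<forall>X\<in>?S. G \<subseteq> X \<longrightarrow> X = G" ..
  have G: "linear_graph R B M G" "F \<subseteq> G" using G_S by simp_all
  have max: "X = G" if "linear_graph R B M X" "G \<subseteq> X" for X
    using G_max that G(2) by simp
  note Gd = linear_graphD[OF G(1)]
  note sv = linear_graph_single_valued[OF B M G(1)]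
  have "\<exists>y. (b, y) \<in> G" if b: "b \<in> carrier B" for b
  proof -
    have "(\<zero>\<^bsub>B\<^esub>, \<zero>\<^bsub>M\<^esub>) \<in> G" using zero G(2) by blast
    then have "\<exists>m G'. linear_graph R B M G' \<and> G \<subseteq> G' \<and> (b, m) \<in> G'"
      by (intro linear_graph_extend[OF B M _ G(1) _ b] ext)
    then obtain m G' where G': "linear_graph R B M G'" "G \<subseteq> G'" "(b, m) \<in> G'"
      by (elim exE conjE)
    \<comment> \<open>Maximality gives \<open>G' = G\<close>, so the pair over \<open>b\<close> was
      already in \<open>G\<close>.\<close>
    then show ?thesis using max[OF G'(1,2)] by (intro exI[of _ m]) simp
  qed
  then obtain g where g: "\<And>b. b \<in> carrier B \<Longrightarrow> (b, g b) \<in> G" by metis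
  \<comment> \<open>In each law both sides are values of \<open>G\<close> over the same element,
    hence equal.\<close>
  have "g \<in> left_hom R B M"
    unfolding left_hom_def
  proof (intro CollectI conjI ballI)
    show "g \<in> carrier B \<rightarrow> carrier M" using Gd(2)[OF g] by simp
    show "g (x \<oplus>\<^bsub>B\<^esub> y) = g x \<oplus>\<^bsub>M\<^esub> g y" if "x \<in> carrier B" "y \<in> carrier B" for x y
      using sv[OF g Gd(3)[OF g g]] that by simp
    show "g (a \<odot>\<^bsub>B\<^esub> x) = a \<odot>\<^bsub>M\<^esub> g x" if "a \<in> carrier R" "x \<in> carrier B" for a x
      using sv[OF g Gd(4)[OF _ g]] that by (simp add: B.smult_closed)
  qed
  moreover have "g x = f x" if "x \<in> carrier A" for x
  proof -
    have "(x, f x) \<in> G" "x \<in> carrier B"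
      using that G(2) AB by (auto simp: F_def left_submodule_def)
    then show ?thesis using sv[OF g] by simp
  qed
  ultimately show "\<exists>g\<in>left_hom R B M. \<forall>x\<in>carrier A. g x = f x" by blast
qed


section \<open>Limit models\<close>

text \<open>A set with fewer than cofinality many elements is not cofinal, and in a linear order a
  set that is not cofinal has an upper bound.\<close>

lemma bounded_of_small:
  assumes \<delta>: "limit_ordinal \<delta>" and "B \<subseteq> Field \<delta>" and small: "|B| <o cofinality \<delta>"
  shows "\<exists>j\<in>Field \<delta>. \<forall>i\<in>B. (i, j) \<in> \<delta>"
proof -
  have "\<not> cofinality \<delta> \<le>o |B|" using small not_ordLess_ordLeq by blast
  then have "\<not> cofinal B \<delta>" using cofinality_least(2)[OF \<delta> assms(2)] by blast
  \<comment> \<open>\<open>cofinal\<close> asks for members strictly above each point, so its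
    failure at \<open>j\<close> leaves room for \<open>j\<close> itself in \<open>B\<close>; the
    bound is therefore not strict.\<close>
  then obtain j where j: "j \<in> Field \<delta>" "\<forall>i\<in>B. j = i \<or> (j, i) \<notin> \<delta>"
    by (auto simp: cofinal_def)
  have wo: "wo_rel \<delta>" using \<delta> by (simp add: limit_ordinal_def wo_rel_def)
  have "(i, j) \<in> \<delta>" if "i \<in> B" for i
    using wo_rel.TOTALS[OF wo] wo_rel.REFL[OF wo] j that assms(2)
    by (metis subset_iff)
  then show ?thesis using j by blast
qed

text \<open>\<open>wo_rel.suc\<close> is the least element strictly above, so it is meaningful only
  when such an element exists; a limit ordinal has no last element.\<close>

lemma limit_ordinal_suc_in_Field:
  assumes \<delta>: "limit_ordinal \<delta>" and j: "j \<in> Field \<delta>"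
  shows "wo_rel.suc \<delta> {j} \<in> Field \<delta>"
proof -
  have wo: "wo_rel \<delta>" using \<delta> by (simp add: limit_ordinal_def wo_rel_def)
  obtain k where "k \<in> Field \<delta>" "j \<noteq> k" "(j, k) \<in> \<delta>" using \<delta> j by (auto simp: limit_ordinal_def)
  then have "AboveS \<delta> {j} \<noteq> {}" by (auto simp: AboveS_def)
  then show ?thesis using wo_rel.suc_inField[OF wo] j by simp
qed

text \<open>The elements of the ideal that \<open>f\<close> sends into \<open>N\<close> form a left
  ideal containing the generators, hence everything. This argument avoids writing elements as linear
  combinations of generators.\<close>

lemma left_hom_gen_closed:
  assumes "ring R" and M: "left_module R M" and N: "left_submodule R N M"
    and A: "A \<subseteq> carrier R" and I: "left_ideal R (left_ideal_gen R A)"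
    and f: "f \<in> left_hom R (ideal_module R (left_ideal_gen R A)) M"
    and fA: "f ` A \<subseteq> carrier N"
  shows "f \<in> left_hom R (ideal_module R (left_ideal_gen R A)) N"
proof -
  interpret ring R by fact
  let ?I = "left_ideal_gen R A"
  interpret I: additive_subgroup ?I R using I by (simp add: left_ideal_def)
  have Nm: "left_module R N" using N by (simp add: left_submodule_def)
  interpret N: left_module R N by (rule Nm)
  have Nd: "\<And>x y. \<lbrakk>x \<in> carrier N; y \<in> carrier N\<rbrakk> \<Longrightarrow> x \<oplus>\<^bsub>M\<^esub> y = x \<oplus>\<^bsub>N\<^esub> y"
    "\<And>a x. \<lbrakk>a \<in> carrier R; x \<in> carrier N\<rbrakk> \<Longrightarrow> a \<odot>\<^bsub>M\<^esub> x = a \<odot>\<^bsub>N\<^esub> x"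
    using N by (auto simp: left_submodule_def)
  have fd: "\<And>x y. \<lbrakk>x \<in> ?I; y \<in> ?I\<rbrakk> \<Longrightarrow> f (x \<oplus>\<^bsub>R\<^esub> y) = f x \<oplus>\<^bsub>M\<^esub> f y"
    "\<And>a x. \<lbrakk>a \<in> carrier R; x \<in> ?I\<rbrakk> \<Longrightarrow> f (a \<otimes>\<^bsub>R\<^esub> x) = a \<odot>\<^bsub>M\<^esub> f x"
    using f by (auto simp: left_hom_def)
  have f0: "f \<zero>\<^bsub>R\<^esub> = \<zero>\<^bsub>N\<^esub>"
    using left_hom_zero[OF _ M f] left_ideal_submodule[OF I] left_submodule_zero[OF N]
    by (simp add: left_submodule_def)
  let ?J = "{x \<in> ?I. f x \<in> carrier N}"
  have "left_ideal R ?J"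
    using I by (intro left_idealI) (auto simp: I.a_Hcarr f0 fd Nd left_ideal_def N.smult_closed)
  moreover have "A \<subseteq> ?J" using fA by (auto simp: left_ideal_gen_def)
  ultimately have "?I \<subseteq> ?J" unfolding left_ideal_gen_def by blast
  then have "f x \<in> carrier N" if "x \<in> ?I" for x using that by blast
  then show ?thesis by (simp add: left_hom_def fd Nd)
qed

lemma limit_model_mu_injective:
  fixes R :: "('a, 'r) ring_scheme" and M :: "('a, 'b) module"
  assumes R: "ring R" and lam: "|carrier R| +c natLeq \<le>o lam"
    and \<delta>: "limit_ordinal \<delta>" and lim: "limit_model R lam \<delta> M"
  shows "mu_injective R (cofinality \<delta>) M"
proof -
  interpret ring R by fact
  obtain C :: "_ \<Rightarrow> ('a, 'b) module" where
    C: "\<forall>i\<in>Field \<delta>. left_module R (C i) \<and> |carrier (C i)| =o lam"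
      "\<forall>i j. (i, j) \<in> \<delta> \<longrightarrow> left_submodule R (C i) (C j)"
      "\<forall>i\<in>Field \<delta>. universal_over R (C (wo_rel.suc \<delta> {i})) (C i)"
      "\<forall>i\<in>Field \<delta>. left_submodule R (C i) M"
    and C_un: "carrier M = (\<Union>i\<in>Field \<delta>. carrier (C i))"
    using lim unfolding limit_model_def by (elim exE conjE)
  have C_card: "\<And>i. i \<in> Field \<delta> \<Longrightarrow> |carrier (C i)| =o lam"
    and C_mono: "\<And>i j. (i, j) \<in> \<delta> \<Longrightarrow> left_submodule R (C i) (C j)"
    and C_univ: "\<And>i. i \<in> Field \<delta> \<Longrightarrow> universal_over R (C (wo_rel.suc \<delta> {i})) (C i)"
    and C_sub: "\<And>i. i \<in> Field \<delta> \<Longrightarrow> left_submodule R (C i) M"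
    using C by simp_all
  have M: "left_module R M"
    using \<delta> C_sub by (auto simp: limit_ordinal_def left_submodule_def)
  have "\<exists>g \<in> left_hom R (ideal_module R (carrier R)) M. \<forall>x\<in>I. g x = f x"
    if I: "left_ideal R I" "lt_generated R (cofinality \<delta>) I"
      and f: "f \<in> left_hom R (ideal_module R I) M" for I f
  proof -
    obtain A where A: "A \<subseteq> carrier R" "|A| <o cofinality \<delta>" "I = left_ideal_gen R A"
      using I(2) by (auto simp: lt_generated_def)
    have "\<exists>i\<in>Field \<delta>. f a \<in> carrier (C i)" if "a \<in> A" for a
    proof -
      have "a \<in> I" using that A(3) by (auto simp: left_ideal_gen_def)
      then have "f a \<in> carrier M" using f by (auto simp: left_hom_def)
      then show ?thesis by (simp add: C_un)
    qed
    \<comment> \<open>\<open>k a\<close> is an index of a stage that contains \<open>f a\<close>.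
      There are at most as many such indices as generators, so some \<open>j\<close> bounds them
      all.\<close>
    then obtain k where k: "\<And>a. a \<in> A \<Longrightarrow> k a \<in> Field \<delta>" "\<And>a. a \<in> A \<Longrightarrow> f a \<in> carrier (C (k a))"
      by metis
    have "|k ` A| <o cofinality \<delta>" using card_of_image A(2) ordLeq_ordLess_trans by blast
    then obtain j where j: "j \<in> Field \<delta>" "\<And>a. a \<in> A \<Longrightarrow> (k a, j) \<in> \<delta>"
      using bounded_of_small[OF \<delta>, of "k ` A"] k(1) by auto
    have "carrier (C (k a)) \<subseteq> carrier (C j)" if "a \<in> A" for a
      using C_mono[OF j(2)[OF that]] by (simp add: left_submodule_def)
    then have "f ` A \<subseteq> carrier (C j)"
      using k(2) by blast
    then have fj: "f \<in> left_hom R (ideal_module R I) (C j)"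
      using left_hom_gen_closed[OF R M C_sub[OF j(1)] A(1)] I f A(3) by simp
    have lamC: "lam =o |carrier (C j)|" using C_card[OF j(1)] by (rule ordIso_symmetric)
    have "natLeq \<le>o lam"
      using ordLeq_transitive[OF ordLeq_csum2[OF natLeq_Card_order] lam] .
    then have "natLeq \<le>o |carrier (C j)|" using lamC ordLeq_ordIso_trans by blast
    then have inf: "infinite (carrier (C j))" using infinite_iff_natLeq_ordLeq by blast
    have "|carrier R| \<le>o lam"
      using ordLeq_transitive[OF ordLeq_csum1[OF card_of_Card_order] lam] .
    then have "|carrier R| \<le>o |carrier (C j)|" using lamC ordLeq_ordIso_trans by blast
    \<comment> \<open>The extension property is applied with the ideal inside \<open>R\<close> as
      test pair and stage \<open>j\<close> as \<open>N\<close>. The bound on \<open>lam\<close>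
      makes this stage infinite and at least as large as \<open>R\<close>.\<close>
    then obtain g where g: "g \<in> left_hom R (ideal_module R (carrier R)) (C (wo_rel.suc \<delta> {j}))"
      and gf: "\<forall>x\<in>I. g x = f x"
      using universal_over_extends[OF C_univ[OF j(1)] inf left_ideal_submodule[OF I(1)] _ fj]
      by auto
    \<comment> \<open>The values of \<open>g\<close> lie in stage \<open>j + 1\<close>, which is
      still indexed below the limit \<open>\<delta>\<close> and so is a submodule of
      \<open>M\<close>.\<close>
    have "(\<lambda>x. x) \<circ> g \<in> left_hom R (ideal_module R (carrier R)) M"
      using left_hom_comp[OF g left_submodule_hom]
        C_sub[OF limit_ordinal_suc_in_Field[OF \<delta> j(1)]] by blast
    then show ?thesis using gf by (intro bexI[of _ g]) (auto simp: comp_def)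
  qed
  then show ?thesis using M by (simp add: mu_injective_def)
qed

theorem lemma3p2:
  fixes R :: "('a, 'r) ring_scheme"
    and lam :: "'l rel"
    and \<delta> :: "'i rel"
    and M :: "('a, 'b) module"
  assumes "ring R"
    and "Card_order lam"
    and "|carrier R| +c natLeq \<le>o lam"
    and "limit_ordinal \<delta>"
    and "\<delta> <o cardSuc lam"
    and "limit_model R lam \<delta> M"
  shows "mu_injective R (cofinality \<delta>) M
    \<and> (gamma R \<le>o cofinality \<delta> \<longrightarrow> left_injective TYPE('c) R M)"
proof (intro conjI impI)
  show inj: "mu_injective R (cofinality \<delta>) M"
    using assms by (intro limit_model_mu_injective)
  assume le: "gamma R \<le>o cofinality \<delta>"
  \<comment> \<open>Fewer than \<open>gamma R\<close> generators are fewer than cofinality many, so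
    the first part covers every left ideal and Baer's criterion applies.\<close>
  have "lt_generated R (cofinality \<delta>) I" if "left_ideal R I" for I
    using gamma_bound_gamma[of R] that ordLess_ordLeq_trans[OF _ le]
    unfolding gamma_bound_def lt_generated_def by blast
  then show "left_injective TYPE('c) R M"
    using inj by (intro Baer_criterion) (auto simp: mu_injective_def)
qed

end
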